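(* Conditional on $x$, the distribution of $(\widehat\nu+T^{-1})/(\nu+T^{-1})$ does not depend on any unknown parameters (that is, it is the same for all values of $a,b,\xi,\sigma_\varepsilon,\sigma_\eta$); in other words, $(\widehat\nu+T^{-1})/(\nu+T^{-1})$ is a pivotal quantity.
   Context: Let $x=(x_{11},\dots,x_{1T},\dots,x_{N1},\dots,x_{NT})$ be given real numbers; all distributions are conditional on $x$, i.e. $x$ is treated as fixed. For $i=1,\dots,N$, $t=1,\dots,T$, $$y_{it}=a+b\,x_{it}+\xi\,\overline{x}_i+\eta_i+\varepsilon_{it},\qquad \overline{x}_i=T^{-1}\sum_{t=1}^T x_{it},$$ where $a,b,\xi\in\mathbb{R}$ are unknown, the $\eta_i$ and $\varepsilon_{it}$ are all independent, $\eta_i\sim N(0,\sigma_\eta^2)$, $\varepsilon_{it}\sim N(0,\sigma_\varepsilon^2)$, with $\sigma_\eta,\sigma_\varepsilon>0$ unknown. Put $\nu=\sigma_\eta^2/\sigma_\varepsilon^2$. Overbars with index $i$ denote averages over $t$ (e.g. $\overline{y}_i$), and overbars without index denote averages of these over $i$ (e.g. $\overline{x}=N^{-1}\sum_i\overline{x}_i$). Let $SSB=\sum_{i}(\overline{x}_i-\overline{x})^2$ and $SSW=\sum_{i}\sum_{t}(x_{it}-\overline{x}_i)^2$, both assumed positive (so $N,T\ge2$). Define $\widetilde b_W=\sum_i\sum_t(x_{it}-\overline{x}_i)(y_{it}-\overline{y}_i)/SSW$ and $\widetilde b_B=\sum_i(\overline{x}_i-\overline{x})(\overline{y}_i-\overline{y})/SSB$.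 With $r_{it}=(y_{it}-\overline{y}_i)-\widetilde b_W(x_{it}-\overline{x}_i)$, let $\widehat\sigma_\varepsilon^2=\frac{1}{N(T-1)}\sum_i\sum_t r_{it}^2$. With $\widetilde a=\overline{y}-\widetilde b_B\overline{x}$ and $\widetilde r_i=\overline{y}_i-(\widetilde a+\widetilde b_B\overline{x}_i)$, let $\widehat\sigma_\eta^2=N^{-1}\sum_i\widetilde r_i^2-T^{-1}\widehat\sigma_\varepsilon^2$. Finally $\widehat\nu=\widehat\sigma_\eta^2/\widehat\sigma_\varepsilon^2$. *)

theory Defs
  imports "HOL-Probability.Probability"
begin

text \<open>
  Panel data are functions of the individual \<open>i \<in> {1..N}\<close> and the period \<open>t \<in> {1..T}\<close>;
  values outside these ranges are never used.
\<close>

definition mean_ind :: "nat \<Rightarrow> (nat \<Rightarrow> nat \<Rightarrow> real) \<Rightarrow> nat \<Rightarrow> real" where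
  "mean_ind T z i = (\<Sum>t=1..T. z i t) / real T"

definition mean_all :: "nat \<Rightarrow> nat \<Rightarrow> (nat \<Rightarrow> nat \<Rightarrow> real) \<Rightarrow> real" where
  "mean_all N T z = (\<Sum>i=1..N. mean_ind T z i) / real N"

definition SSB :: "nat \<Rightarrow> nat \<Rightarrow> (nat \<Rightarrow> nat \<Rightarrow> real) \<Rightarrow> real" where
  "SSB N T x = (\<Sum>i=1..N. (mean_ind T x i - mean_all N T x)\<^sup>2)"

definition SSW :: "nat \<Rightarrow> nat \<Rightarrow> (nat \<Rightarrow> nat \<Rightarrow> real) \<Rightarrow> real" where
  "SSW N T x = (\<Sum>i=1..N. \<Sum>t=1..T. (x i t - mean_ind T x i)\<^sup>2)"

definition b_within :: "nat \<Rightarrow> nat \<Rightarrow> (nat \<Rightarrow> nat \<Rightarrow> real) \<Rightarrow> (nat \<Rightarrow> nat \<Rightarrow> real) \<Rightarrow> real" where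
  "b_within N T x y =
     (\<Sum>i=1..N. \<Sum>t=1..T. (x i t - mean_ind T x i) * (y i t - mean_ind T y i)) / SSW N T x"

definition b_between :: "nat \<Rightarrow> nat \<Rightarrow> (nat \<Rightarrow> nat \<Rightarrow> real) \<Rightarrow> (nat \<Rightarrow> nat \<Rightarrow> real) \<Rightarrow> real" where
  "b_between N T x y =
     (\<Sum>i=1..N. (mean_ind T x i - mean_all N T x) * (mean_ind T y i - mean_all N T y)) / SSB N T x"

definition resid_within ::
  "nat \<Rightarrow> nat \<Rightarrow> (nat \<Rightarrow> nat \<Rightarrow> real) \<Rightarrow> (nat \<Rightarrow> nat \<Rightarrow> real) \<Rightarrow> nat \<Rightarrow> nat \<Rightarrow> real" where
  "resid_within N T x y i t =
     (y i t - mean_ind T y i) - b_within N T x y * (x i t - mean_ind T x i)"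

definition var_eps_hat :: "nat \<Rightarrow> nat \<Rightarrow> (nat \<Rightarrow> nat \<Rightarrow> real) \<Rightarrow> (nat \<Rightarrow> nat \<Rightarrow> real) \<Rightarrow> real" where
  "var_eps_hat N T x y =
     (1 / (real N * (real T - 1))) * (\<Sum>i=1..N. \<Sum>t=1..T. (resid_within N T x y i t)\<^sup>2)"

definition a_between :: "nat \<Rightarrow> nat \<Rightarrow> (nat \<Rightarrow> nat \<Rightarrow> real) \<Rightarrow> (nat \<Rightarrow> nat \<Rightarrow> real) \<Rightarrow> real" where
  "a_between N T x y = mean_all N T y - b_between N T x y * mean_all N T x"

definition resid_between ::
  "nat \<Rightarrow> nat \<Rightarrow> (nat \<Rightarrow> nat \<Rightarrow> real) \<Rightarrow> (nat \<Rightarrow> nat \<Rightarrow> real) \<Rightarrow> nat \<Rightarrow> real" where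
  "resid_between N T x y i =
     mean_ind T y i - (a_between N T x y + b_between N T x y * mean_ind T x i)"

text \<open>May be negative: it is a difference of two estimators and is not truncated at 0.\<close>

definition var_eta_hat :: "nat \<Rightarrow> nat \<Rightarrow> (nat \<Rightarrow> nat \<Rightarrow> real) \<Rightarrow> (nat \<Rightarrow> nat \<Rightarrow> real) \<Rightarrow> real" where
  "var_eta_hat N T x y =
     (\<Sum>i=1..N. (resid_between N T x y i)\<^sup>2) / real N - var_eps_hat N T x y / real T"

text \<open>
  If \<open>var_eps_hat\<close> is 0, division by zero yields 0. In the model below, with \<open>SSB\<close> and
  \<open>SSW\<close> positive, this is an event of probability 0.
\<close>

definition nu_hat :: "nat \<Rightarrow> nat \<Rightarrow> (nat \<Rightarrow> nat \<Rightarrow> real) \<Rightarrow> (nat \<Rightarrow> nat \<Rightarrow> real) \<Rightarrow> real" where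
  "nu_hat N T x y = var_eta_hat N T x y / var_eps_hat N T x y"

text \<open>
  The random effects model with fixed regressor \<open>x\<close>. Joint independence of all \<open>\<eta> i\<close> and
  \<open>\<epsilon> i t\<close> is expressed by a single family indexed by the disjoint sum of the two index sets.
  The second parameter of \<^const>\<open>normal_density\<close> is the standard deviation.
\<close>

locale random_effects_model = prob_space M
  for M :: "'w measure" +
  fixes N T :: nat
    and x :: "nat \<Rightarrow> nat \<Rightarrow> real"
    and a b \<xi> \<sigma>\<^sub>\<eta> \<sigma>\<^sub>\<epsilon> :: real
    and \<eta> :: "nat \<Rightarrow> 'w \<Rightarrow> real"
    and \<epsilon> :: "nat \<Rightarrow> nat \<Rightarrow> 'w \<Rightarrow> real"
    and y :: "nat \<Rightarrow> nat \<Rightarrow> 'w \<Rightarrow> real"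
  assumes sigma_eta_pos: "\<sigma>\<^sub>\<eta> > 0"
    and sigma_eps_pos: "\<sigma>\<^sub>\<epsilon> > 0"
    and indep: "indep_vars (\<lambda>_. borel) (case_sum \<eta> (\<lambda>(i, t). \<epsilon> i t))
                  ({1..N} <+> ({1..N} \<times> {1..T}))"
    and eta_normal: "\<And>i. i \<in> {1..N} \<Longrightarrow>
                  distributed M lborel (\<eta> i) (normal_density 0 \<sigma>\<^sub>\<eta>)"
    and eps_normal: "\<And>i t. i \<in> {1..N} \<Longrightarrow> t \<in> {1..T} \<Longrightarrow>
                  distributed M lborel (\<epsilon> i t) (normal_density 0 \<sigma>\<^sub>\<epsilon>)"
    and outcome: "\<And>i t \<omega>. i \<in> {1..N} \<Longrightarrow> t \<in> {1..T} \<Longrightarrow> \<omega> \<in> space M \<Longrightarrow>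
                  y i t \<omega> = a + b * x i t + \<xi> * mean_ind T x i + \<eta> i \<omega> + \<epsilon> i t \<omega>"

definition nu_pivot ::
  "nat \<Rightarrow> nat \<Rightarrow> (nat \<Rightarrow> nat \<Rightarrow> real) \<Rightarrow> real \<Rightarrow> real \<Rightarrow> (nat \<Rightarrow> nat \<Rightarrow> 'w \<Rightarrow> real) \<Rightarrow> 'w \<Rightarrow> real" where
  "nu_pivot N T x \<sigma>\<^sub>\<eta> \<sigma>\<^sub>\<epsilon> y \<omega> =
     (nu_hat N T x (\<lambda>i t. y i t \<omega>) + 1 / real T) / (\<sigma>\<^sub>\<eta>\<^sup>2 / \<sigma>\<^sub>\<epsilon>\<^sup>2 + 1 / real T)"

end

theory Submission
  imports Defs
begin

text \<open>
  Let \<open>u\<^sub>i = \<eta>\<^sub>i + mean\<^sub>t \<epsilon>\<^sub>i\<^sub>t\<close>. The within residuals depend only on the deviations of \<open>\<epsilon>\<close> from its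
  individual means and the between residuals only on \<open>u\<close>, in both cases linearly and free of
  \<open>a\<close>, \<open>b\<close>, \<open>\<xi>\<close>. The vector \<open>u\<close> is independent of the deviations and consists of
  independent normal variables with variance \<open>\<sigma>\<^sub>\<eta>\<^sup>2 + \<sigma>\<^sub>\<epsilon>\<^sup>2 / T = \<sigma>\<^sub>\<epsilon>\<^sup>2 (\<nu> + 1 / T)\<close>. Since
  \<open>\<nu>_hat + 1 / T\<close> is the quotient of the mean squared between residual by \<open>var_eps_hat\<close>, division
  by \<open>\<nu> + 1 / T\<close> makes it the same function of standard normal variables for all parameters.

  Independence is obtained without multivariate characteristic functions: against
  Lebesgue measure, substitute \<open>\<eta> = u - mean \<epsilon>\<close> and then translate each row of \<open>\<epsilon>\<close> by a multiple of
  \<open>u\<^sub>i\<close>, chosen to cancel the mixed term in the exponent; the deviations do not notice the translation.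
\<close>

section \<open>Lebesgue measure on finite products: translations and densities\<close>

interpretation lborel_prod: product_sigma_finite "\<lambda>_. lborel :: real measure"
  by standard

text \<open>Product measures are determined on boxes, and the preimage of a box under a translation
  is again a box, so the one-dimensional invariance suffices. Restriction to \<open>I\<close> keeps
  the translated point inside the extensional functions.\<close>

lemma distr_PiM_lborel_translate:
  fixes c :: "'i \<Rightarrow> real"
  assumes "finite I"
  shows "distr (PiM I (\<lambda>_. lborel)) (PiM I (\<lambda>_. lborel)) (\<lambda>z. \<lambda>i\<in>I. z i + c i) = PiM I (\<lambda>_. lborel)"
proof (rule lborel_prod.PiM_eqI[OF assms])
  fix A :: "'i \<Rightarrow> real set"
  assume A: "\<And>i. i \<in> I \<Longrightarrow> A i \<in> sets lborel"
  let ?B = "\<lambda>i. (\<lambda>u. u + c i) -` A i"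
  have B: "?B i \<in> sets lborel" "emeasure lborel (?B i) = emeasure lborel (A i)" if "i \<in> I" for i
  proof -
    have m: "(\<lambda>u. u + c i) \<in> measurable borel borel" by simp
    show "?B i \<in> sets lborel"
      using measurable_sets[OF m, of "A i"] A[OF that] by simp
    have "emeasure lborel (A i) = emeasure (distr lborel borel ((+) (c i))) (A i)"
      by (subst lborel_distr_plus) simp
    also have "\<dots> = emeasure lborel ((+) (c i) -` A i)"
      using A[OF that] by (subst emeasure_distr) auto
    finally show "emeasure lborel (?B i) = emeasure lborel (A i)"
      by (simp add: vimage_def add.commute)
  qed
  have pre: "(\<lambda>z. \<lambda>i\<in>I. z i + c i) -` Pi\<^sub>E I A \<inter> space (PiM I (\<lambda>_. lborel)) = Pi\<^sub>E I ?B"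
    by (auto simp: space_PiM PiE_iff extensional_def)
  have "emeasure (distr (PiM I (\<lambda>_. lborel)) (PiM I (\<lambda>_. lborel)) (\<lambda>z. \<lambda>i\<in>I. z i + c i)) (Pi\<^sub>E I A)
      = emeasure (PiM I (\<lambda>_. lborel)) (Pi\<^sub>E I ?B)"
    using A assms by (subst emeasure_distr) (auto simp: pre intro!: sets_PiM_I_finite)
  also have "\<dots> = (\<Prod>i\<in>I. emeasure lborel (?B i))"
    using B assms by (intro lborel_prod.emeasure_PiM) auto
  also have "\<dots> = (\<Prod>i\<in>I. emeasure lborel (A i))"
    using B by (intro prod.cong) auto
  finally show "emeasure (distr (PiM I (\<lambda>_. lborel)) (PiM I (\<lambda>_. lborel)) (\<lambda>z. \<lambda>i\<in>I. z i + c i)) (Pi\<^sub>E I A)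
      = (\<Prod>i\<in>I. emeasure lborel (A i))" .
qed simp

lemma nn_integral_PiM_lborel_translate:
  fixes c :: "'i \<Rightarrow> real"
  assumes "finite I" and [measurable]: "f \<in> borel_measurable (PiM I (\<lambda>_. lborel))"
  shows "(\<integral>\<^sup>+z. f (\<lambda>i\<in>I. z i + c i) \<partial>PiM I (\<lambda>_. lborel)) = (\<integral>\<^sup>+z. f z \<partial>PiM I (\<lambda>_. lborel))"
  by (subst (2) distr_PiM_lborel_translate[OF assms(1), of c, symmetric])
     (subst nn_integral_distr, simp_all)

text \<open>On a box, density and indicator both factor over the coordinates, and the integral of
  such a product over a product measure is the product of the integrals.\<close>

lemma PiM_density_lborel:
  fixes f :: "'i \<Rightarrow> real \<Rightarrow> ennreal"
  assumes I: "finite I" and f[measurable]: "\<And>i. f i \<in> borel_measurable borel"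
    and sf: "\<And>i. sigma_finite_measure (density lborel (f i))"
  shows "PiM I (\<lambda>i. density lborel (f i)) = density (PiM I (\<lambda>_. lborel)) (\<lambda>z. \<Prod>i\<in>I. f i (z i))"
proof -
  interpret product_sigma_finite "\<lambda>i. density lborel (f i)"
    using sf by (simp add: product_sigma_finite_def)
  show ?thesis
  proof (rule PiM_eqI[OF I, symmetric])
    show "sets (density (PiM I (\<lambda>_. lborel)) (\<lambda>z. \<Prod>i\<in>I. f i (z i))) = sets (PiM I (\<lambda>i. density lborel (f i)))"
      by (simp cong: sets_PiM_cong)
    fix A :: "'i \<Rightarrow> real set"
    assume "\<And>i. i \<in> I \<Longrightarrow> A i \<in> sets (density lborel (f i))"
    then have A: "\<And>i. i \<in> I \<Longrightarrow> A i \<in> sets borel" by simp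
    have "emeasure (density (PiM I (\<lambda>_. lborel)) (\<lambda>z. \<Prod>i\<in>I. f i (z i))) (Pi\<^sub>E I A)
        = (\<integral>\<^sup>+z. (\<Prod>i\<in>I. f i (z i)) * indicator (Pi\<^sub>E I A) z \<partial>PiM I (\<lambda>_. lborel))"
      using A I by (intro emeasure_density) (auto intro!: sets_PiM_I_finite)
    also have "\<dots> = (\<integral>\<^sup>+z. (\<Prod>i\<in>I. f i (z i) * indicator (A i) (z i)) \<partial>PiM I (\<lambda>_. lborel))"
    proof (rule nn_integral_cong)
      fix z :: "'i \<Rightarrow> real" assume "z \<in> space (PiM I (\<lambda>_. lborel))"
      then have z: "z \<in> extensional I" by (simp add: space_PiM PiE_iff)
      have "indicator (Pi\<^sub>E I A) z = (\<Prod>i\<in>I. indicator (A i) (z i) :: ennreal)"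
        using z I by (auto simp: indicator_def PiE_iff prod_zero_iff)
      then show "(\<Prod>i\<in>I. f i (z i)) * indicator (Pi\<^sub>E I A) z = (\<Prod>i\<in>I. f i (z i) * indicator (A i) (z i))"
        by (simp add: prod.distrib)
    qed
    also have "\<dots> = (\<Prod>i\<in>I. \<integral>\<^sup>+u. f i u * indicator (A i) u \<partial>lborel)"
      using A by (intro lborel_prod.product_nn_integral_prod[OF I]) auto
    also have "\<dots> = (\<Prod>i\<in>I. emeasure (density lborel (f i)) (A i))"
      using A by (intro prod.cong refl) (simp add: emeasure_density)
    finally show "emeasure (density (PiM I (\<lambda>_. lborel)) (\<lambda>z. \<Prod>i\<in>I. f i (z i))) (Pi\<^sub>E I A)
      = (\<Prod>i\<in>I. emeasure (density lborel (f i)) (A i))" .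
  qed
qed

section \<open>Laws of independent centered normal families\<close>

text \<open>Working with laws on a product space instead of random variables on \<open>M\<close>
  permits changes of variables, and comparison of models living on different probability
  spaces.\<close>

definition iid_normal :: "'i set \<Rightarrow> real \<Rightarrow> ('i \<Rightarrow> real) measure" where
  "iid_normal I \<sigma> = PiM I (\<lambda>_. density lborel (normal_density 0 \<sigma>))"

lemma sets_iid_normal [measurable_cong]: "sets (iid_normal I \<sigma>) = sets (PiM I (\<lambda>_. borel))"
  unfolding iid_normal_def by (simp cong: sets_PiM_cong)

lemma prob_space_iid_normal: "\<sigma> > 0 \<Longrightarrow> prob_space (iid_normal I \<sigma>)"
  unfolding iid_normal_def by (intro prob_space_PiM prob_space_normal_density)

lemma iid_normal_eq_density:
  assumes "finite I" "\<sigma> > 0"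
  shows "iid_normal I \<sigma> = density (PiM I (\<lambda>_. lborel)) (\<lambda>z. ennreal (\<Prod>i\<in>I. normal_density 0 \<sigma> (z i)))"
proof -
  interpret prob_space "density lborel (normal_density 0 \<sigma>)"
    by (intro prob_space_normal_density assms)
  have "sigma_finite_measure (density lborel (normal_density 0 \<sigma>))" by unfold_locales
  then show ?thesis
    unfolding iid_normal_def using assms
    by (subst PiM_density_lborel) (auto simp: prod_ennreal)
qed

lemma nn_integral_iid_normal:
  assumes "finite I" "\<sigma> > 0" and [measurable]: "f \<in> borel_measurable (PiM I (\<lambda>_. borel))"
  shows "(\<integral>\<^sup>+z. f z \<partial>iid_normal I \<sigma>)
    = (\<integral>\<^sup>+z. ennreal (\<Prod>i\<in>I. normal_density 0 \<sigma> (z i)) * f z \<partial>PiM I (\<lambda>_. lborel))"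
  unfolding iid_normal_eq_density[OF assms(1,2)] 
  by (rule nn_integral_density) measurable

text \<open>Each coordinate is an affine image of a standard normal variable. This later moves every
  parameter out of the law and into the integrand.\<close>

lemma iid_normal_scale:
  assumes "finite I" "\<sigma> > 0"
  shows "iid_normal I \<sigma> = distr (iid_normal I 1) (PiM I (\<lambda>_. borel)) (\<lambda>z. \<lambda>i\<in>I. \<sigma> * z i)"
proof -
  interpret S: prob_space "density lborel (normal_density 0 1)"
    by (intro prob_space_normal_density) simp
  have "distributed (density lborel (normal_density 0 1)) lborel (\<lambda>x. x) (normal_density 0 1)"
    unfolding distributed_def by (auto simp: distr_id2 cong: distr_cong)
  from S.normal_density_affine[OF this, of \<sigma> 0] assms
  have *: "distr (density lborel (normal_density 0 1)) lborel ((*) \<sigma>) = density lborel (normal_density 0 \<sigma>)"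
    by (simp add: distributed_def)
  have **: "distr (density lborel (normal_density 0 1)) borel ((*) \<sigma>) = density lborel (normal_density 0 \<sigma>)"
    unfolding *[symmetric] by (intro distr_cong) auto
  \<comment> \<open>Only the sigma-algebra of the target matters to \<open>distr\<close>. A product
    of probability spaces is put in its place to fit the rule for coordinatewise images.\<close>
  have "distr (iid_normal I 1) (PiM I (\<lambda>_. borel)) (compose I ((*) \<sigma>))
      = distr (iid_normal I 1) (PiM I (\<lambda>_. density lborel (normal_density 0 \<sigma>))) (compose I ((*) \<sigma>))"
    by (intro distr_cong sets_PiM_cong) auto
  also have "\<dots> = PiM I (\<lambda>_. distr (density lborel (normal_density 0 1)) (density lborel (normal_density 0 \<sigma>)) ((*) \<sigma>))"
    unfolding iid_normal_def
    using assms by (intro distr_PiM_finite_prob_space') (auto intro: prob_space_normal_density)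
  also have "\<dots> = PiM I (\<lambda>_. distr (density lborel (normal_density 0 1)) borel ((*) \<sigma>))"
    by (intro PiM_cong distr_cong) auto
  finally show ?thesis
    unfolding ** compose_def[abs_def] by (simp add: iid_normal_def)
qed

section \<open>Decoupling the individual totals from the within deviations\<close>

text \<open>Here \<open>A\<close> is the variance of the effect, \<open>b\<close> that of the mean
  of \<open>n\<close> errors, \<open>m\<close> this mean and \<open>Q\<close> the sum of squared
  errors. The mixed terms are \<open>- u * m / (A + b)\<close> and \<open>u * m / (A + b)\<close>,
  and the \<open>u\<^sup>2\<close> terms add up to
  \<open>(A + b) / (2 * (A + b)\<^sup>2)\<close>.\<close>

lemma Gaussian_exponent_shift:
  fixes A b n u m Q :: real
  assumes "A > 0" "b > 0" "n > 0"
  shows "((A / (A + b)) * u - m)\<^sup>2 / (2 * A)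
       + (Q + 2 * (b / (A + b)) * u * (n * m) + n * ((b / (A + b)) * u)\<^sup>2) / (2 * (n * b))
     = u\<^sup>2 / (2 * (A + b)) + m\<^sup>2 / (2 * A) + Q / (2 * (n * b))"
proof -
  define G where "G = A + b"
  have G: "G > 0" "b = G - A" using assms by (auto simp: G_def)
  show ?thesis
    \<comment> \<open>With \<open>A + b\<close> as the atom \<open>G\<close>, clearing denominators
      stays simple; \<open>b = G - A\<close> then leaves a polynomial identity.\<close>
    unfolding G_def[symmetric] using assms G(1)
    by (simp add: divide_simps) (simp add: G(2) power2_eq_square algebra_simps)
qed

lemma prod_normal_density:
  "(\<Prod>t\<in>K. normal_density 0 \<sigma> (h t))
     = (1 / sqrt (2 * pi * \<sigma>\<^sup>2)) ^ card K * exp (- (\<Sum>t\<in>K. (h t)\<^sup>2) / (2 * \<sigma>\<^sup>2))"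
proof (cases "finite K")
  case True
  then show ?thesis
    by (simp add: normal_density_def prod.distrib exp_sum[symmetric] sum_divide_distrib sum_negf prod_dividef
        power_one_over power_divide)
qed simp

text \<open>The constant \<open>\<kappa>\<close> is the regression coefficient of the error mean on
  the total \<open>u\<close>, the variance of that mean divided by the variance of \<open>u\<close>.
  Translating the errors by \<open>\<kappa> * u\<close> therefore makes the joint density a product.
  The first argument is \<open>u\<close> minus the translated mean, and dividing by the density at 0
  restores the normalising constant for \<open>\<gamma>\<close>.\<close>

lemma normal_density_shift:
  fixes h :: "'t \<Rightarrow> real"
  assumes "finite K" "K \<noteq> {}" "\<sigma> > 0" "\<tau> > 0"
  defines "\<gamma> \<equiv> sqrt (\<sigma>\<^sup>2 + \<tau>\<^sup>2 / card K)"
  defines "\<kappa> \<equiv> (\<tau>\<^sup>2 / card K) / \<gamma>\<^sup>2"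
  defines "m \<equiv> (\<Sum>t\<in>K. h t) / card K"
  shows "normal_density 0 \<sigma> ((1 - \<kappa>) * u - m) * (\<Prod>t\<in>K. normal_density 0 \<tau> (h t + \<kappa> * u))
     = normal_density 0 \<gamma> u * (normal_density 0 \<sigma> m * (\<Prod>t\<in>K. normal_density 0 \<tau> (h t)) / normal_density 0 \<gamma> 0)"
proof -
  define n where "n = real (card K)"
  define b where "b = \<tau>\<^sup>2 / n"
  define A where "A = \<sigma>\<^sup>2"
  have pos: "n > 0" "b > 0" "A > 0"
    using assms by (auto simp: n_def b_def A_def card_gt_0_iff)
  have G: "\<gamma>\<^sup>2 = A + b"
    unfolding \<gamma>_def using pos by (simp add: n_def[symmetric] b_def[symmetric] A_def[symmetric])
  have \<tau>2: "\<tau>\<^sup>2 = n * b" using pos by (simp add: b_def)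
  have \<kappa>: "\<kappa> = b / (A + b)" "1 - \<kappa> = A / (A + b)"
    unfolding \<kappa>_def G using pos by (simp_all add: n_def[symmetric] b_def[symmetric] field_simps)
  have S: "(\<Sum>t\<in>K. h t) = n * m" using pos unfolding m_def n_def by simp
  have "(\<Sum>t\<in>K. (h t + \<kappa> * u)\<^sup>2) = (\<Sum>t\<in>K. (h t)\<^sup>2) + 2 * \<kappa> * u * (\<Sum>t\<in>K. h t) + n * (\<kappa> * u)\<^sup>2"
    by (simp add: power2_sum sum.distrib n_def sum_distrib_left sum_distrib_right mult_ac)
  then have Q: "(\<Sum>t\<in>K. (h t + \<kappa> * u)\<^sup>2) = (\<Sum>t\<in>K. (h t)\<^sup>2) + 2 * \<kappa> * u * (n * m) + n * (\<kappa> * u)\<^sup>2"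
    unfolding S .
  have neg_sum: "- w + - x = - y + (- z + - v)" if "w + x = y + z + v" for v w x y z :: real
    using that by simp
  have "exp (- ((1 - \<kappa>) * u - m)\<^sup>2 / (2 * \<sigma>\<^sup>2)) * exp (- (\<Sum>t\<in>K. (h t + \<kappa> * u)\<^sup>2) / (2 * \<tau>\<^sup>2))
      = exp (- u\<^sup>2 / (2 * \<gamma>\<^sup>2)) * (exp (- m\<^sup>2 / (2 * \<sigma>\<^sup>2)) * exp (- (\<Sum>t\<in>K. (h t)\<^sup>2) / (2 * \<tau>\<^sup>2)))"
    using Gaussian_exponent_shift[OF pos(3,2,1), of u m "\<Sum>t\<in>K. (h t)\<^sup>2"]
    unfolding Q exp_add[symmetric] G \<tau>2 A_def[symmetric] unfolding \<kappa>(2) unfolding \<kappa>(1)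
    unfolding minus_divide_left[symmetric]
    by (intro arg_cong[of _ _ exp]) (rule neg_sum)
  moreover have "\<gamma> > 0" using pos by (simp add: \<gamma>_def n_def[symmetric] b_def[symmetric] A_def[symmetric])
  ultimately show ?thesis
    unfolding prod_normal_density unfolding normal_density_def[of 0] using assms(3,4)
    by (simp add: mult_ac)
qed

text \<open>Independence in integral form: by \<open>inv\<close>, \<open>F\<close> sees
  \<open>h\<close> only through its deviations from the row means, so the vector of totals can be
  replaced by a normal vector drawn independently of \<open>h\<close>. Nonnegative integrands avoid
  all integrability questions.\<close>

lemma nn_integral_iid_normal_decouple:
  fixes F :: "('i \<Rightarrow> real) \<Rightarrow> ('i \<times> 't \<Rightarrow> real) \<Rightarrow> ennreal"
  assumes fin: "finite I" "finite K" "K \<noteq> {}" and pos: "\<sigma> > 0" "\<tau> > 0"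
    and F [measurable]: "case_prod F \<in> borel_measurable (PiM I (\<lambda>_. borel) \<Otimes>\<^sub>M PiM (I \<times> K) (\<lambda>_. borel))"
    and inv: "\<And>v h c. F v (\<lambda>p\<in>I \<times> K. h p + c (fst p)) = F v h"
  shows "(\<integral>\<^sup>+g. \<integral>\<^sup>+h. F (\<lambda>i\<in>I. g i + (\<Sum>t\<in>K. h (i, t)) / card K) h \<partial>iid_normal (I \<times> K) \<tau> \<partial>iid_normal I \<sigma>)
       = (\<integral>\<^sup>+u. \<integral>\<^sup>+h. F u h \<partial>iid_normal (I \<times> K) \<tau> \<partial>iid_normal I (sqrt (\<sigma>\<^sup>2 + \<tau>\<^sup>2 / card K)))"
proof -
  define \<gamma> where "\<gamma> = sqrt (\<sigma>\<^sup>2 + \<tau>\<^sup>2 / card K)"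
  define \<kappa> where "\<kappa> = (\<tau>\<^sup>2 / card K) / \<gamma>\<^sup>2"
  define m where "m h i = (\<Sum>t\<in>K. h (i, t)) / card K" for h :: "'i \<times> 't \<Rightarrow> real" and i
  define p where "p s v = (\<Prod>i\<in>I. normal_density 0 s (v i))" for s and v :: "'i \<Rightarrow> real"
  define q where "q h = (\<Prod>k\<in>I \<times> K. normal_density 0 \<tau> (h k))" for h :: "'i \<times> 't \<Rightarrow> real"
  \<comment> \<open>The factor of the joint density that remains once the density of
    \<open>u\<close> is split off. It is the density of the errors after \<open>\<kappa>\<close>
    times \<open>u\<close> has been subtracted from each row.\<close>
  define W where "W h = p \<sigma> (m h) * q h / p \<gamma> (\<lambda>_. 0)" for h
  let ?L = "PiM I (\<lambda>_. lborel :: real measure)" and ?L' = "PiM (I \<times> K) (\<lambda>_. lborel :: real measure)"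
  have \<gamma>: "\<gamma> > 0"
    using pos fin unfolding \<gamma>_def by (simp add: card_gt_0_iff add_pos_nonneg)
  have finJ: "finite (I \<times> K)" using fin by simp
  interpret L: sigma_finite_measure ?L by (intro lborel_prod.sigma_finite fin)
  interpret L': sigma_finite_measure ?L' by (intro lborel_prod.sigma_finite finJ)
  interpret P: pair_sigma_finite ?L ?L' ..
  interpret N: prob_space "iid_normal I \<sigma>" by (intro prob_space_iid_normal pos)
  interpret N'': prob_space "iid_normal I \<gamma>" by (intro prob_space_iid_normal \<gamma>)
  have nonneg: "p s v \<ge> 0" "q h \<ge> 0" for s v h
    by (auto simp: p_def q_def intro!: prod_nonneg)
  have [measurable]: "p s \<in> borel_measurable (PiM I (\<lambda>_. borel))" for s
    unfolding p_def by measurable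
  have q [measurable]: "q \<in> borel_measurable (PiM (I \<times> K) (\<lambda>_. borel))"
    unfolding q_def by measurable
  have m [measurable]: "(\<lambda>h. m h i) \<in> borel_measurable (PiM (I \<times> K) (\<lambda>_. borel))" if "i \<in> I" for i
    unfolding m_def using that
    by (intro borel_measurable_divide borel_measurable_sum measurable_component_singleton) auto
  have [measurable]: "(\<lambda>h. p \<sigma> (m h)) \<in> borel_measurable (PiM (I \<times> K) (\<lambda>_. borel))"
    unfolding p_def by measurable
  have W [measurable]: "W \<in> borel_measurable (PiM (I \<times> K) (\<lambda>_. borel))"
    unfolding W_def by measurable
  \<comment> \<open>Row by row this is \<open>normal_density_shift\<close>, since the translation
    raises the mean of row \<open>i\<close> by \<open>\<kappa> * u i\<close>.\<close>
  have shift: "p \<sigma> (\<lambda>i. u i - m (\<lambda>k\<in>I \<times> K. h k + \<kappa> * u (fst k)) i) * q (\<lambda>k\<in>I \<times> K. h k + \<kappa> * u (fst k))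
      = p \<gamma> u * W h" for u h
  proof -
    have "m (\<lambda>k\<in>I \<times> K. h k + \<kappa> * u (fst k)) i = m h i + \<kappa> * u i" if "i \<in> I" for i
      using that fin by (simp add: m_def sum.distrib field_simps)
    then have "p \<sigma> (\<lambda>i. u i - m (\<lambda>k\<in>I \<times> K. h k + \<kappa> * u (fst k)) i) = p \<sigma> (\<lambda>i. (1 - \<kappa>) * u i - m h i)"
      unfolding p_def by (intro prod.cong refl) (simp add: algebra_simps)
    moreover have "q (\<lambda>k\<in>I \<times> K. h k + \<kappa> * u (fst k)) = (\<Prod>i\<in>I. \<Prod>t\<in>K. normal_density 0 \<tau> (h (i, t) + \<kappa> * u i))"
      unfolding q_def by (subst prod.cartesian_product) (intro prod.cong, auto)
    moreover have qh: "q h = (\<Prod>i\<in>I. \<Prod>t\<in>K. normal_density 0 \<tau> (h (i, t)))"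
      unfolding q_def by (subst prod.cartesian_product) (intro prod.cong, auto)
    ultimately have "p \<sigma> (\<lambda>i. u i - m (\<lambda>k\<in>I \<times> K. h k + \<kappa> * u (fst k)) i) * q (\<lambda>k\<in>I \<times> K. h k + \<kappa> * u (fst k))
        = (\<Prod>i\<in>I. normal_density 0 \<sigma> ((1 - \<kappa>) * u i - m h i) * (\<Prod>t\<in>K. normal_density 0 \<tau> (h (i, t) + \<kappa> * u i)))"
      by (simp only: p_def prod.distrib)
    also have "\<dots> = (\<Prod>i\<in>I. normal_density 0 \<gamma> (u i)
        * (normal_density 0 \<sigma> (m h i) * (\<Prod>t\<in>K. normal_density 0 \<tau> (h (i, t))) / normal_density 0 \<gamma> 0))"
      unfolding m_def
      by (simp only: normal_density_shift[OF fin(2,3) pos, folded \<gamma>_def, folded \<kappa>_def])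
    also have "\<dots> = p \<gamma> u * W h"
      unfolding W_def p_def qh by (simp only: prod.distrib prod_dividef)
    finally show ?thesis .
  qed
  \<comment> \<open>Stated for general \<open>G\<close> because it is applied twice: to
    \<open>F\<close> itself and to integrands constant in the first argument.\<close>
  have decouple: "(\<integral>\<^sup>+g. \<integral>\<^sup>+h. G (\<lambda>i\<in>I. g i + m h i) h \<partial>iid_normal (I \<times> K) \<tau> \<partial>iid_normal I \<sigma>)
      = (\<integral>\<^sup>+u. \<integral>\<^sup>+h. ennreal (W h) * G u h \<partial>?L' \<partial>iid_normal I \<gamma>)"
    if G [measurable]: "case_prod G \<in> borel_measurable (PiM I (\<lambda>_. borel) \<Otimes>\<^sub>M PiM (I \<times> K) (\<lambda>_. borel))"
      and Ginv: "\<And>v h c. G v (\<lambda>p\<in>I \<times> K. h p + c (fst p)) = G v h" for G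
  proof -
    have Gu: "G u \<in> borel_measurable (PiM (I \<times> K) (\<lambda>_. borel))" if "u \<in> space ?L" for u
    proof -
      from that have "u \<in> space (PiM I (\<lambda>_. borel))" by (simp add: space_PiM)
      from measurable_compose[OF measurable_Pair1'[OF this] G] show ?thesis by simp
    qed
    have "(\<integral>\<^sup>+g. \<integral>\<^sup>+h. G (\<lambda>i\<in>I. g i + m h i) h \<partial>iid_normal (I \<times> K) \<tau> \<partial>iid_normal I \<sigma>)
        = (\<integral>\<^sup>+g. ennreal (p \<sigma> g) * (\<integral>\<^sup>+h. ennreal (q h) * G (\<lambda>i\<in>I. g i + m h i) h \<partial>?L') \<partial>?L)"
      using fin pos by (simp add: nn_integral_iid_normal p_def q_def)
    also have "\<dots> = (\<integral>\<^sup>+g. \<integral>\<^sup>+h. ennreal (p \<sigma> g) * (ennreal (q h) * G (\<lambda>i\<in>I. g i + m h i) h) \<partial>?L' \<partial>?L)"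
      by (intro nn_integral_cong nn_integral_cmult[symmetric]) measurable
    \<comment> \<open>Fubini puts \<open>h\<close> outside, so that for fixed \<open>h\<close> the
      map from \<open>g\<close> to \<open>u\<close> is a translation by the constant vector
      \<open>m h\<close>.\<close>
    also have "\<dots> = (\<integral>\<^sup>+h. \<integral>\<^sup>+g. ennreal (p \<sigma> g) * (ennreal (q h) * G (\<lambda>i\<in>I. g i + m h i) h) \<partial>?L \<partial>?L')"
      by (intro P.Fubini'[symmetric]) measurable
    also have "\<dots> = (\<integral>\<^sup>+h. \<integral>\<^sup>+u. ennreal (p \<sigma> (\<lambda>i. u i - m h i)) * (ennreal (q h) * G u h) \<partial>?L \<partial>?L')"
    proof (rule nn_integral_cong)
      fix h assume "h \<in> space ?L'"
      then have "h \<in> space (PiM (I \<times> K) (\<lambda>_. borel))" by (simp add: space_PiM)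
      from measurable_compose[OF measurable_Pair2'[OF this] G]
      have Gh: "(\<lambda>u. G u h) \<in> borel_measurable (PiM I (\<lambda>_. borel))" by simp
      have "(\<lambda>u. p \<sigma> (\<lambda>i. u i - m h i)) \<in> borel_measurable (PiM I (\<lambda>_. borel))"
        unfolding p_def by measurable
      then have "(\<lambda>u. ennreal (p \<sigma> (\<lambda>i. u i - m h i)) * (ennreal (q h) * G u h)) \<in> borel_measurable (PiM I (\<lambda>_. borel))"
        by (intro borel_measurable_times_ennreal measurable_compose[OF _ measurable_ennreal] borel_measurable_const Gh)
      then have meas: "(\<lambda>u. ennreal (p \<sigma> (\<lambda>i. u i - m h i)) * (ennreal (q h) * G u h)) \<in> borel_measurable ?L"
        by (simp cong: measurable_cong_sets sets_PiM_cong)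
      show "(\<integral>\<^sup>+g. ennreal (p \<sigma> g) * (ennreal (q h) * G (\<lambda>i\<in>I. g i + m h i) h) \<partial>?L)
          = (\<integral>\<^sup>+u. ennreal (p \<sigma> (\<lambda>i. u i - m h i)) * (ennreal (q h) * G u h) \<partial>?L)"
      proof -
        have "p \<sigma> g = p \<sigma> (\<lambda>i. (\<lambda>i\<in>I. g i + m h i) i - m h i)" for g
          unfolding p_def by (intro prod.cong) auto
        then have "(\<integral>\<^sup>+g. ennreal (p \<sigma> g) * (ennreal (q h) * G (\<lambda>i\<in>I. g i + m h i) h) \<partial>?L)
          = (\<integral>\<^sup>+g. (\<lambda>u. ennreal (p \<sigma> (\<lambda>i. u i - m h i)) * (ennreal (q h) * G u h)) (\<lambda>i\<in>I. g i + m h i) \<partial>?L)"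
          by (intro nn_integral_cong) metis
        also have "\<dots> = (\<integral>\<^sup>+u. ennreal (p \<sigma> (\<lambda>i. u i - m h i)) * (ennreal (q h) * G u h) \<partial>?L)"
          by (rule nn_integral_PiM_lborel_translate[OF fin(1) meas])
        finally show ?thesis .
      qed
    qed
    \<comment> \<open>The order is exchanged back: now \<open>u\<close> is fixed and each row of
      \<open>h\<close> is translated by a constant, which \<open>G\<close> does not notice.\<close>
    also have "\<dots> = (\<integral>\<^sup>+u. \<integral>\<^sup>+h. ennreal (p \<sigma> (\<lambda>i. u i - m h i)) * (ennreal (q h) * G u h) \<partial>?L' \<partial>?L)"
    proof -
      have [measurable]: "(\<lambda>(u, h). p \<sigma> (\<lambda>i. u i - m h i)) \<in> borel_measurable (?L \<Otimes>\<^sub>M ?L')"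
        unfolding p_def by measurable
      have "(\<lambda>(u, h). ennreal (p \<sigma> (\<lambda>i. u i - m h i)) * (ennreal (q h) * G u h)) \<in> borel_measurable (?L \<Otimes>\<^sub>M ?L')"
        by measurable
      from P.Fubini'[OF this] show ?thesis .
    qed
    also have "\<dots> = (\<integral>\<^sup>+u. \<integral>\<^sup>+h. ennreal (p \<gamma> u) * (ennreal (W h) * G u h) \<partial>?L' \<partial>?L)"
    proof (rule nn_integral_cong)
      fix u assume u: "u \<in> space ?L"
      have "(\<lambda>h. p \<sigma> (\<lambda>i. u i - m h i)) \<in> borel_measurable (PiM (I \<times> K) (\<lambda>_. borel))"
        unfolding p_def by measurable
      then have "(\<lambda>h. ennreal (p \<sigma> (\<lambda>i. u i - m h i)) * (ennreal (q h) * G u h)) \<in> borel_measurable (PiM (I \<times> K) (\<lambda>_. borel))"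
        by (intro borel_measurable_times_ennreal measurable_compose[OF _ measurable_ennreal] q Gu u)
      then have meas: "(\<lambda>h. ennreal (p \<sigma> (\<lambda>i. u i - m h i)) * (ennreal (q h) * G u h)) \<in> borel_measurable ?L'"
        by (simp cong: measurable_cong_sets sets_PiM_cong)
      have "(\<integral>\<^sup>+h. ennreal (p \<sigma> (\<lambda>i. u i - m h i)) * (ennreal (q h) * G u h) \<partial>?L')
          = (\<integral>\<^sup>+h. (\<lambda>h. ennreal (p \<sigma> (\<lambda>i. u i - m h i)) * (ennreal (q h) * G u h)) (\<lambda>k\<in>I \<times> K. h k + \<kappa> * u (fst k)) \<partial>?L')"
        by (rule nn_integral_PiM_lborel_translate[OF finJ meas, symmetric])
      also have "\<dots> = (\<integral>\<^sup>+h. ennreal (p \<gamma> u) * (ennreal (W h) * G u h) \<partial>?L')"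
      proof (rule nn_integral_cong)
        fix h :: "'i \<times> 't \<Rightarrow> real"
        have "W h \<ge> 0" using nonneg by (simp add: W_def)
        then show "(\<lambda>h. ennreal (p \<sigma> (\<lambda>i. u i - m h i)) * (ennreal (q h) * G u h)) (\<lambda>k\<in>I \<times> K. h k + \<kappa> * u (fst k))
            = ennreal (p \<gamma> u) * (ennreal (W h) * G u h)"
          using nonneg shift[of u h] Ginv[of u h "\<lambda>i. \<kappa> * u i"]
          by (simp add: ennreal_mult[symmetric] mult.assoc[symmetric])
      qed
      finally show "(\<integral>\<^sup>+h. ennreal (p \<sigma> (\<lambda>i. u i - m h i)) * (ennreal (q h) * G u h) \<partial>?L')
          = (\<integral>\<^sup>+h. ennreal (p \<gamma> u) * (ennreal (W h) * G u h) \<partial>?L')" .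
    qed
    also have "\<dots> = (\<integral>\<^sup>+u. ennreal (p \<gamma> u) * (\<integral>\<^sup>+h. ennreal (W h) * G u h \<partial>?L') \<partial>?L)"
    proof (rule nn_integral_cong)
      fix u assume "u \<in> space ?L"
      then have "(\<lambda>h. ennreal (W h) * G u h) \<in> borel_measurable (PiM (I \<times> K) (\<lambda>_. borel))"
        by (intro borel_measurable_times_ennreal measurable_compose[OF _ measurable_ennreal] W Gu)
      then have "(\<lambda>h. ennreal (W h) * G u h) \<in> borel_measurable ?L'"
        by (simp cong: measurable_cong_sets sets_PiM_cong)
      then show "(\<integral>\<^sup>+h. ennreal (p \<gamma> u) * (ennreal (W h) * G u h) \<partial>?L')
          = ennreal (p \<gamma> u) * (\<integral>\<^sup>+h. ennreal (W h) * G u h \<partial>?L')"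
        by (rule nn_integral_cmult)
    qed
    also have "\<dots> = (\<integral>\<^sup>+u. \<integral>\<^sup>+h. ennreal (W h) * G u h \<partial>?L' \<partial>iid_normal I \<gamma>)"
      using fin \<gamma> by (simp add: nn_integral_iid_normal p_def)
    finally show ?thesis .
  qed
  \<comment> \<open>The same identity for integrands not depending on \<open>u\<close> shows that the weight \<open>W\<close>
    integrates shift-invariant functions like the normal density does.\<close>
  have "(\<integral>\<^sup>+h. ennreal (W h) * F u h \<partial>?L') = (\<integral>\<^sup>+h. F u h \<partial>iid_normal (I \<times> K) \<tau>)"
    if u [measurable]: "u \<in> space (PiM I (\<lambda>_. borel))" for u
    using decouple[of "\<lambda>_. F u"] inv by (simp add: N.emeasure_space_1 N''.emeasure_space_1)
  then have "(\<integral>\<^sup>+u. \<integral>\<^sup>+h. ennreal (W h) * F u h \<partial>?L' \<partial>iid_normal I \<gamma>)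
      = (\<integral>\<^sup>+u. \<integral>\<^sup>+h. F u h \<partial>iid_normal (I \<times> K) \<tau> \<partial>iid_normal I \<gamma>)"
    by (intro nn_integral_cong) (simp add: iid_normal_def space_PiM)
  then show ?thesis
    using decouple[OF F inv] by (simp add: \<gamma>_def m_def restrict_def)
qed

section \<open>Behaviour of the estimators under affine changes of the data\<close>

lemma mean_ind_affine:
  assumes "T > 0" and "\<And>t. t \<in> {1..T} \<Longrightarrow> y i t = c + \<beta> * x i t + s * e i t"
  shows "mean_ind T y i = c + \<beta> * mean_ind T x i + s * mean_ind T e i"
proof -
  have "(\<Sum>t=1..T. y i t) = (\<Sum>t=1..T. c + \<beta> * x i t + s * e i t)"
    using assms(2) by (intro sum.cong) auto
  then show ?thesis
    using assms(1) by (simp add: mean_ind_def sum.distrib sum_distrib_left[symmetric] field_simps)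
qed

text \<open>Centering removes \<open>c i\<close>, the fitted slope absorbs \<open>\<beta>\<close>,
  and what remains of each residual is linear in \<open>e\<close>. Letting \<open>c\<close> vary
  with \<open>i\<close> covers the random effects.\<close>

lemma var_eps_hat_affine:
  assumes "T > 0" "SSW N T x > 0"
    and y: "\<And>i t. i \<in> {1..N} \<Longrightarrow> t \<in> {1..T} \<Longrightarrow> y i t = c i + \<beta> * x i t + s * e i t"
  shows "var_eps_hat N T x y = s\<^sup>2 * var_eps_hat N T x e"
proof -
  have dev: "y i t - mean_ind T y i = \<beta> * (x i t - mean_ind T x i) + s * (e i t - mean_ind T e i)"
    if "i \<in> {1..N}" "t \<in> {1..T}" for i t
    using that y mean_ind_affine[OF assms(1), of y i "c i" \<beta> x s e] by (simp add: algebra_simps)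
  have "(\<Sum>i=1..N. \<Sum>t=1..T. (x i t - mean_ind T x i) * (y i t - mean_ind T y i))
      = (\<Sum>i=1..N. \<Sum>t=1..T. \<beta> * (x i t - mean_ind T x i)\<^sup>2 + s * ((x i t - mean_ind T x i) * (e i t - mean_ind T e i)))"
    by (intro sum.cong refl, subst dev) (auto simp: algebra_simps power2_eq_square)
  also have "\<dots> = \<beta> * SSW N T x + s * (\<Sum>i=1..N. \<Sum>t=1..T. (x i t - mean_ind T x i) * (e i t - mean_ind T e i))"
    by (simp add: sum.distrib sum_distrib_left SSW_def)
  finally have b: "b_within N T x y = \<beta> + s * b_within N T x e"
    using assms(2) by (simp add: b_within_def add_divide_distrib)
  have "resid_within N T x y i t = s * resid_within N T x e i t" if "i \<in> {1..N}" "t \<in> {1..T}" for i t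
    unfolding resid_within_def b dev[OF that] by (simp add: algebra_simps)
  then have "(\<Sum>i=1..N. \<Sum>t=1..T. (resid_within N T x y i t)\<^sup>2)
      = (\<Sum>i=1..N. \<Sum>t=1..T. s\<^sup>2 * (resid_within N T x e i t)\<^sup>2)"
    by (intro sum.cong refl) (simp add: power_mult_distrib)
  then show ?thesis
    by (simp add: var_eps_hat_def sum_distrib_left)
qed

text \<open>Intercept and slope of the fitted line absorb \<open>c\<close> and
  \<open>\<beta>\<close>. Only individual means enter, so an error vector \<open>v\<close> is
  encoded as a panel constant in time. Unlike in the within case, \<open>c\<close> must be common to
  all individuals.\<close>

lemma resid_between_affine:
  assumes "T > 0" "SSB N T x > 0" "i \<in> {1..N}"
    and y: "\<And>i. i \<in> {1..N} \<Longrightarrow> mean_ind T y i = c + \<beta> * mean_ind T x i + s * v i"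
  shows "resid_between N T x y i = s * resid_between N T x (\<lambda>i _. v i) i"
proof -
  have v: "mean_ind T (\<lambda>i _. v i) i = v i" for i
    using assms(1) by (simp add: mean_ind_def)
  define e where "e = (\<lambda>i (_ :: nat). v i)"
  have e: "mean_ind T e i = v i" for i
    by (simp add: e_def v)
  have mean: "mean_all N T y = c + \<beta> * mean_all N T x + s * mean_all N T e"
  proof -
    have "(\<Sum>i=1..N. mean_ind T y i) = (\<Sum>i=1..N. c + \<beta> * mean_ind T x i + s * mean_ind T e i)"
      using y by (intro sum.cong) (auto simp: e)
    then show ?thesis
      using assms(3) by (simp add: mean_all_def sum.distrib sum_distrib_left[symmetric] field_simps)
  qed
  have dev: "mean_ind T y i - mean_all N T y
      = \<beta> * (mean_ind T x i - mean_all N T x) + s * (mean_ind T e i - mean_all N T e)"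
    if "i \<in> {1..N}" for i
    using y[OF that] by (simp add: mean e algebra_simps)
  have "(\<Sum>i=1..N. (mean_ind T x i - mean_all N T x) * (mean_ind T y i - mean_all N T y))
      = (\<Sum>i=1..N. \<beta> * (mean_ind T x i - mean_all N T x)\<^sup>2
          + s * ((mean_ind T x i - mean_all N T x) * (mean_ind T e i - mean_all N T e)))"
    by (intro sum.cong refl, subst dev) (auto simp: algebra_simps power2_eq_square)
  also have "\<dots> = \<beta> * SSB N T x + s * (\<Sum>i=1..N. (mean_ind T x i - mean_all N T x) * (mean_ind T e i - mean_all N T e))"
    by (simp add: sum.distrib sum_distrib_left SSB_def)
  finally have b: "b_between N T x y = \<beta> + s * b_between N T x e"
    using assms(2) by (simp add: b_between_def add_divide_distrib)
  show ?thesis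
    unfolding e_def[symmetric] resid_between_def a_between_def b mean y[OF assms(3)] e
    by (simp add: algebra_simps)
qed

lemma two_le_if_SSB_pos:
  assumes "SSB N T x > 0"
  shows "N \<ge> 2"
proof (rule ccontr)
  assume "\<not> N \<ge> 2"
  then have "N = 0 \<or> N = 1" by auto
  then show False using assms by (auto simp: SSB_def mean_all_def)
qed

lemma two_le_if_SSW_pos:
  assumes "SSW N T x > 0"
  shows "T \<ge> 2"
proof (rule ccontr)
  assume "\<not> T \<ge> 2"
  then have "T = 0 \<or> T = 1" by auto
  then show False using assms by (auto simp: SSW_def mean_ind_def)
qed

section \<open>The ratio behind the pivot\<close>

text \<open>This is the estimator of \<open>\<nu> + 1 / T\<close> as a function of the errors alone.
  The total errors \<open>v\<close> and the idiosyncratic errors \<open>h\<close> are separate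
  arguments so that they can be given independent laws.\<close>

definition scale_free_ratio :: "nat \<Rightarrow> nat \<Rightarrow> (nat \<Rightarrow> nat \<Rightarrow> real) \<Rightarrow> (nat \<Rightarrow> real) \<Rightarrow> (nat \<times> nat \<Rightarrow> real) \<Rightarrow> real" where
  "scale_free_ratio N T x v h = ((\<Sum>i=1..N. (resid_between N T x (\<lambda>i _. v i) i)\<^sup>2) / real N)
     / var_eps_hat N T x (\<lambda>i t. h (i, t))"

text \<open>Used in two ways: \<open>r = s = 1\<close> with arbitrary \<open>c\<close> gives the
  invariance needed for decoupling, and \<open>c = 0\<close> extracts the standard deviations from
  the normal families.\<close>

lemma scale_free_ratio_scale:
  assumes "T > 0" "SSB N T x > 0" "SSW N T x > 0"
    and v: "\<And>i. i \<in> {1..N} \<Longrightarrow> v' i = r * v i"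
    and h: "\<And>i t. i \<in> {1..N} \<Longrightarrow> t \<in> {1..T} \<Longrightarrow> h' (i, t) = c i + s * h (i, t)"
  shows "scale_free_ratio N T x v' h' = r\<^sup>2 / s\<^sup>2 * scale_free_ratio N T x v h"
proof -
  have "var_eps_hat N T x (\<lambda>i t. h' (i, t)) = s\<^sup>2 * var_eps_hat N T x (\<lambda>i t. h (i, t))"
    using h by (intro var_eps_hat_affine[where c = c and \<beta> = 0] assms) auto
  moreover have "resid_between N T x (\<lambda>i _. v' i) i = r * resid_between N T x (\<lambda>i _. v i) i" if "i \<in> {1..N}" for i
    using that assms(1) v by (intro resid_between_affine[where c = 0 and \<beta> = 0] assms) (auto simp: mean_ind_def)
  then have "(\<Sum>i=1..N. (resid_between N T x (\<lambda>i _. v' i) i)\<^sup>2) = r\<^sup>2 * (\<Sum>i=1..N. (resid_between N T x (\<lambda>i _. v i) i)\<^sup>2)"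
    by (simp add: sum_distrib_left power_mult_distrib)
  ultimately show ?thesis
    by (simp add: scale_free_ratio_def)
qed

text \<open>The correction subtracted in \<open>var_eta_hat\<close> contributes
  \<open>- 1 / T\<close> after division, which is exactly compensated. With a zero denominator the
  quotient would be 0 and the identity could fail.\<close>

lemma nu_hat_add_inverse:
  assumes "T > 0" "var_eps_hat N T x y \<noteq> 0"
  shows "nu_hat N T x y + 1 / real T = ((\<Sum>i=1..N. (resid_between N T x y i)\<^sup>2) / real N) / var_eps_hat N T x y"
  using assms by (simp add: nu_hat_def var_eta_hat_def field_simps)

lemma measurable_scale_free_ratio [measurable]:
  "(\<lambda>(v, h). scale_free_ratio N T x v h)
     \<in> borel_measurable (PiM {1..N} (\<lambda>_. borel) \<Otimes>\<^sub>M PiM ({1..N} \<times> {1..T}) (\<lambda>_. borel))"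
proof -
  let ?P = "PiM {1..N} (\<lambda>_. borel :: real measure) \<Otimes>\<^sub>M PiM ({1..N} \<times> {1..T}) (\<lambda>_. borel :: real measure)"
  have v [measurable]: "(\<lambda>p. fst p i) \<in> borel_measurable ?P" if "i \<in> {1..N}" for i
    using that by (intro measurable_compose[OF measurable_fst measurable_component_singleton])
  have h [measurable]: "(\<lambda>p. snd p (i, t)) \<in> borel_measurable ?P" if "i \<in> {1..N}" "t \<in> {1..T}" for i t
    using that by (intro measurable_compose[OF measurable_snd measurable_component_singleton]) auto
  show ?thesis
    unfolding scale_free_ratio_def var_eps_hat_def resid_within_def b_within_def resid_between_def a_between_def
      b_between_def mean_all_def mean_ind_def case_prod_unfold
    by measurable
qed

section \<open>Independent families, joint laws and null events\<close>

text \<open>An injection carries finite subfamilies to finite subfamilies without merging factors.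
  It serves to strip \<open>Inl\<close> and \<open>Inr\<close> from the indices of the
  model.\<close>

lemma (in prob_space) indep_vars_reindex:
  assumes f: "inj_on f I" and ind: "indep_vars M' X (f ` I)"
  shows "indep_vars (\<lambda>i. M' (f i)) (\<lambda>i. X (f i)) I"
  unfolding indep_vars_def2
proof (intro conjI ballI)
  let ?F = "\<lambda>k. {X k -` A \<inter> space M | A. A \<in> sets (M' k)}"
  show "random_variable (M' (f i)) (X (f i))" if "i \<in> I" for i
    using ind that by (auto simp: indep_vars_def2)
  have F: "indep_sets ?F (f ` I)"
    using ind by (simp add: indep_vars_def2)
  show "indep_sets (\<lambda>i. ?F (f i)) I"
  proof (rule indep_setsI)
    show "?F (f i) \<subseteq> events" if "i \<in> I" for i
      using F that by (auto simp: indep_sets_def)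
    fix A J assume J: "J \<noteq> {}" "J \<subseteq> I" "finite J" and A: "\<forall>j\<in>J. A j \<in> ?F (f j)"
    \<comment> \<open>The events are transported to the image index set along the inverse of
      \<open>f\<close> on \<open>J\<close>.\<close>
    define B where "B k = A (the_inv_into J f k)" for k
    have inj: "inj_on f J" using f J(2) by (rule inj_on_subset)
    have B: "B (f j) = A j" if "j \<in> J" for j
      using that by (simp add: B_def the_inv_into_f_f[OF inj])
    have "prob (\<Inter>k\<in>f ` J. B k) = (\<Prod>k\<in>f ` J. prob (B k))"
      using J A by (intro indep_setsD[OF F]) (auto simp: B)
    then show "prob (\<Inter>j\<in>J. A j) = (\<Prod>j\<in>J. prob (A j))"
      by (simp add: prod.reindex[OF inj] B cong: INF_cong_simp)
  qed
qed

lemma (in prob_space) distr_iid_normal: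
  assumes "indep_vars (\<lambda>_. borel) X I" "I \<noteq> {}"
    and X: "\<And>i. i \<in> I \<Longrightarrow> distributed M lborel (X i) (normal_density 0 \<sigma>)"
  shows "distr M (PiM I (\<lambda>_. borel)) (\<lambda>\<omega>. \<lambda>i\<in>I. X i \<omega>) = iid_normal I \<sigma>"
proof -
  have rv: "X i \<in> borel_measurable M" if "i \<in> I" for i
    using distributed_measurable[OF X[OF that]] by simp
  have "distr M borel (X i) = density lborel (normal_density 0 \<sigma>)" if "i \<in> I" for i
    using distributed_distr_eq_density[OF X[OF that]] by (simp cong: distr_cong)
  then have "(\<Pi>\<^sub>M i\<in>I. distr M borel (X i)) = iid_normal I \<sigma>"
    unfolding iid_normal_def by (intro PiM_cong) auto
  then show ?thesis
    using indep_vars_iff_distr_eq_PiM'[OF assms(2), where M' = "\<lambda>_. borel" and X = X] rv assms(1) by simp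
qed

text \<open>The combination is normal with positive variance, hence has a density and does not
  charge the point 0.\<close>

lemma (in prob_space) AE_normal_lincomb_nonzero:
  assumes J: "finite J" and ind: "indep_vars (\<lambda>_. borel) X J" and "\<sigma> > 0"
    and X: "\<And>k. k \<in> J \<Longrightarrow> distributed M lborel (X k) (normal_density 0 \<sigma>)"
    and "k \<in> J" "c k \<noteq> 0"
  shows "AE \<omega> in M. (\<Sum>k\<in>J. c k * X k \<omega>) \<noteq> 0"
proof -
  \<comment> \<open>Terms with coefficient 0 are degenerate and have no normal density, so they are
    dropped before summing.\<close>
  define S where "S = {k \<in> J. c k \<noteq> 0}"
  have S: "finite S" "S \<noteq> {}" "S \<subseteq> J" using assms by (auto simp: S_def)
  have ind': "indep_vars (\<lambda>_. borel) (\<lambda>k \<omega>. c k * X k \<omega>) S"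
    by (rule indep_vars_compose2[OF indep_vars_subset[OF ind S(3)]]) measurable
  have X': "distributed M lborel (\<lambda>\<omega>. c k * X k \<omega>) (normal_density 0 (\<bar>c k\<bar> * \<sigma>))" if "k \<in> S" for k
    using normal_density_affine[OF X, of k "c k" 0] that S assms(3) by (auto simp: S_def)
  have "distributed M lborel (\<lambda>\<omega>. \<Sum>k\<in>S. c k * X k \<omega>)
      (normal_density (\<Sum>k\<in>S. 0) (sqrt (\<Sum>k\<in>S. (\<bar>c k\<bar> * \<sigma>)\<^sup>2)))"
    using X' assms(3) by (intro sum_indep_normal S ind') (auto simp: S_def)
  then have "AE \<omega> in M. (\<Sum>k\<in>S. c k * X k \<omega>) \<noteq> 0"
    by (subst distributed_AE2) (auto intro: AE_mp[OF AE_lborel_singleton])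
  moreover have "(\<Sum>k\<in>S. c k * X k \<omega>) = (\<Sum>k\<in>J. c k * X k \<omega>)" for \<omega>
    using J by (intro sum.mono_neutral_left) (auto simp: S_def)
  ultimately show ?thesis by simp
qed

lemma measurable_iid_normal_pair:
  "measurable (iid_normal I \<sigma> \<Otimes>\<^sub>M iid_normal J \<tau>) L = measurable (PiM I (\<lambda>_. borel) \<Otimes>\<^sub>M PiM J (\<lambda>_. borel)) L"
  by (intro measurable_cong_sets sets_pair_measure_cong sets_iid_normal refl)

lemma iid_normal_pair_scale:
  assumes "finite I" "finite J" "\<sigma> > 0" "\<tau> > 0"
  shows "iid_normal I \<sigma> \<Otimes>\<^sub>M iid_normal J \<tau>
    = distr (iid_normal I 1 \<Otimes>\<^sub>M iid_normal J 1) (PiM I (\<lambda>_. borel) \<Otimes>\<^sub>M PiM J (\<lambda>_. borel))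
        (\<lambda>(v, h). (\<lambda>i\<in>I. \<sigma> * v i, \<lambda>k\<in>J. \<tau> * h k))"
proof -
  interpret prob_space "iid_normal J \<tau>" using assms by (intro prob_space_iid_normal)
  show ?thesis
    unfolding iid_normal_scale[OF assms(1,3)] iid_normal_scale[OF assms(2,4)]
    by (intro pair_measure_distr)
       (simp_all add: iid_normal_scale[OF assms(2,4), symmetric] sigma_finite_measure_axioms)
qed

text \<open>A vanishing sum of squares forces every residual to vanish, so the data fit the within
  regression exactly.\<close>

lemma var_eps_hat_eq_0D:
  assumes "var_eps_hat N T x e = 0" "N > 0" "T > 1" "i \<in> {1..N}" "t \<in> {1..T}"
  shows "e i t = mean_ind T e i + b_within N T x e * (x i t - mean_ind T x i)"
proof -
  have "(\<Sum>i=1..N. \<Sum>t=1..T. (resid_within N T x e i t)\<^sup>2) = 0"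
    using assms(1-3) by (simp add: var_eps_hat_def)
  then have "(resid_within N T x e i t)\<^sup>2 = 0"
    using assms(4,5) by (simp add: sum_nonneg_eq_0_iff sum_nonneg)
  then show ?thesis by (simp add: resid_within_def)
qed

section \<open>The law of the pivot in the model\<close>

context random_effects_model
begin

lemma indep_eta: "indep_vars (\<lambda>_. borel) \<eta> {1..N}"
proof -
  have "indep_vars (\<lambda>_. borel) (case_sum \<eta> (\<lambda>(i, t). \<epsilon> i t)) (Inl ` {1..N})"
    by (rule indep_vars_subset[OF indep]) auto
  from indep_vars_reindex[OF _ this] show ?thesis by simp
qed

lemma indep_eps: "indep_vars (\<lambda>_. borel) (\<lambda>(i, t). \<epsilon> i t) ({1..N} \<times> {1..T})"
proof -
  have "indep_vars (\<lambda>_. borel) (case_sum \<eta> (\<lambda>(i, t). \<epsilon> i t)) (Inr ` ({1..N} \<times> {1..T}))"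
    by (rule indep_vars_subset[OF indep]) auto
  from indep_vars_reindex[OF _ this] show ?thesis by simp
qed

lemma measurable_eta [measurable]: "i \<in> {1..N} \<Longrightarrow> \<eta> i \<in> borel_measurable M"
  using distributed_measurable[OF eta_normal] by simp

lemma measurable_eps [measurable]: "i \<in> {1..N} \<Longrightarrow> t \<in> {1..T} \<Longrightarrow> \<epsilon> i t \<in> borel_measurable M"
  using distributed_measurable[OF eps_normal] by simp

lemma measurable_outcome [measurable]:
  assumes "i \<in> {1..N}" "t \<in> {1..T}"
  shows "y i t \<in> borel_measurable M"
proof -
  have "(\<lambda>\<omega>. a + b * x i t + \<xi> * mean_ind T x i + \<eta> i \<omega> + \<epsilon> i t \<omega>) \<in> borel_measurable M"
    using assms by measurable
  then show ?thesis
    by (subst measurable_cong[OF outcome[OF assms]])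
qed

lemma measurable_nu_pivot: "nu_pivot N T x \<sigma>\<^sub>\<eta> \<sigma>\<^sub>\<epsilon> y \<in> borel_measurable M"
  unfolding nu_pivot_def nu_hat_def var_eta_hat_def var_eps_hat_def resid_within_def b_within_def
    resid_between_def a_between_def b_between_def mean_all_def mean_ind_def
  by measurable

text \<open>The family over the disjoint sum splits into two independent blocks, whose joint law is
  a product. Dropping the constructors acts on each block separately and so preserves the
  product.\<close>

lemma distr_eta_eps:
  assumes "N > 0" "T > 0"
  shows "distr M (PiM {1..N} (\<lambda>_. borel) \<Otimes>\<^sub>M PiM ({1..N} \<times> {1..T}) (\<lambda>_. borel))
           (\<lambda>\<omega>. (\<lambda>i\<in>{1..N}. \<eta> i \<omega>, \<lambda>(i, t)\<in>{1..N} \<times> {1..T}. \<epsilon> i t \<omega>))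
       = iid_normal {1..N} \<sigma>\<^sub>\<eta> \<Otimes>\<^sub>M iid_normal ({1..N} \<times> {1..T}) \<sigma>\<^sub>\<epsilon>"
proof -
  let ?I = "{1..N}" and ?J = "{1..N} \<times> {1..T}"
  let ?X = "case_sum \<eta> (\<lambda>(i, t). \<epsilon> i t)"
  let ?P = "distr M (PiM (Inl ` ?I) (\<lambda>_. borel)) (\<lambda>\<omega>. \<lambda>k\<in>Inl ` ?I. ?X k \<omega>)"
  let ?Q = "distr M (PiM (Inr ` ?J) (\<lambda>_. borel)) (\<lambda>\<omega>. \<lambda>k\<in>Inr ` ?J. ?X k \<omega>)"
  have "indep_var (PiM (Inl ` ?I) (\<lambda>_. borel)) (\<lambda>\<omega>. \<lambda>k\<in>Inl ` ?I. ?X k \<omega>)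
                  (PiM (Inr ` ?J) (\<lambda>_. borel)) (\<lambda>\<omega>. \<lambda>k\<in>Inr ` ?J. ?X k \<omega>)"
    by (rule indep_var_restrict[OF indep]) auto
  then have joint: "?P \<Otimes>\<^sub>M ?Q
      = distr M (PiM (Inl ` ?I) (\<lambda>_. borel) \<Otimes>\<^sub>M PiM (Inr ` ?J) (\<lambda>_. borel))
          (\<lambda>\<omega>. (\<lambda>k\<in>Inl ` ?I. ?X k \<omega>, \<lambda>k\<in>Inr ` ?J. ?X k \<omega>))"
    and rv [measurable]: "(\<lambda>\<omega>. \<lambda>k\<in>Inl ` ?I. ?X k \<omega>) \<in> measurable M (PiM (Inl ` ?I) (\<lambda>_. borel))"
      "(\<lambda>\<omega>. \<lambda>k\<in>Inr ` ?J. ?X k \<omega>) \<in> measurable M (PiM (Inr ` ?J) (\<lambda>_. borel))"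
    by (simp_all add: indep_var_distribution_eq)
  let ?f = "\<lambda>g. \<lambda>i\<in>?I. g (Inl i)" and ?g = "\<lambda>h. \<lambda>k\<in>?J. h (Inr k)"
  have f [measurable]: "?f \<in> measurable (PiM (Inl ` ?I) (\<lambda>_. borel)) (PiM ?I (\<lambda>_. borel :: real measure))"
    by (intro measurable_restrict measurable_component_singleton) auto
  have g [measurable]: "?g \<in> measurable (PiM (Inr ` ?J) (\<lambda>_. borel)) (PiM ?J (\<lambda>_. borel :: real measure))"
    by (intro measurable_restrict measurable_component_singleton) auto
  have "distr ?P (PiM ?I (\<lambda>_. borel)) ?f = distr M (PiM ?I (\<lambda>_. borel)) (\<lambda>\<omega>. \<lambda>i\<in>?I. \<eta> i \<omega>)"
    by (subst distr_distr[OF f rv(1)]) (auto intro!: distr_cong simp: comp_def restrict_def)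
  also have "\<dots> = iid_normal ?I \<sigma>\<^sub>\<eta>"
    using assms by (intro distr_iid_normal indep_eta eta_normal) auto
  finally have P: "distr ?P (PiM ?I (\<lambda>_. borel)) ?f = iid_normal ?I \<sigma>\<^sub>\<eta>" .
  have "distr ?Q (PiM ?J (\<lambda>_. borel)) ?g = distr M (PiM ?J (\<lambda>_. borel)) (\<lambda>\<omega>. \<lambda>k\<in>?J. (\<lambda>(i, t). \<epsilon> i t) k \<omega>)"
    by (subst distr_distr[OF g rv(2)]) (auto intro!: distr_cong simp: comp_def restrict_def)
  also have "\<dots> = iid_normal ?J \<sigma>\<^sub>\<epsilon>"
    using assms by (intro distr_iid_normal indep_eps) (auto intro: eps_normal)
  finally have Q: "distr ?Q (PiM ?J (\<lambda>_. borel)) ?g = iid_normal ?J \<sigma>\<^sub>\<epsilon>" .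
  interpret Q: prob_space "iid_normal ?J \<sigma>\<^sub>\<epsilon>"
    by (intro prob_space_iid_normal sigma_eps_pos)
  have fg: "(\<lambda>(u, v). (?f u, ?g v)) \<in> measurable
      (PiM (Inl ` ?I) (\<lambda>_. borel) \<Otimes>\<^sub>M PiM (Inr ` ?J) (\<lambda>_. borel)) (PiM ?I (\<lambda>_. borel) \<Otimes>\<^sub>M PiM ?J (\<lambda>_. borel))"
    using measurable_Pair[OF measurable_compose[OF measurable_fst f] measurable_compose[OF measurable_snd g]]
    by (simp add: case_prod_unfold)
  note rv' = measurable_Pair[OF rv]
  have sf: "sigma_finite_measure (distr ?Q (PiM ?J (\<lambda>_. borel)) ?g)"
    unfolding Q by (rule Q.sigma_finite_measure_axioms)
  have "iid_normal ?I \<sigma>\<^sub>\<eta> \<Otimes>\<^sub>M iid_normal ?J \<sigma>\<^sub>\<epsilon>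
      = distr (?P \<Otimes>\<^sub>M ?Q) (PiM ?I (\<lambda>_. borel) \<Otimes>\<^sub>M PiM ?J (\<lambda>_. borel)) (\<lambda>(u, v). (?f u, ?g v))"
    unfolding P[symmetric] Q[symmetric] by (intro pair_measure_distr sf) simp_all
  also have "\<dots> = distr M (PiM ?I (\<lambda>_. borel) \<Otimes>\<^sub>M PiM ?J (\<lambda>_. borel))
      (\<lambda>\<omega>. (\<lambda>i\<in>?I. \<eta> i \<omega>, \<lambda>(i, t)\<in>?J. \<epsilon> i t \<omega>))"
    unfolding joint
    by (subst distr_distr[OF fg rv']) (auto intro!: distr_cong simp: comp_def restrict_def fun_eq_iff)
  finally show ?thesis by simp
qed

text \<open>This makes the default value of division by zero in \<open>nu_hat\<close>
  harmless.\<close>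

lemma AE_var_eps_hat_nonzero:
  assumes "N \<ge> 2" "T \<ge> 2"
  shows "AE \<omega> in M. var_eps_hat N T x (\<lambda>i t. \<epsilon> i t \<omega>) \<noteq> 0"
proof -
  let ?J = "{1..N} \<times> {1..T}"
  define p q where "p = x 1 1 - x 1 2" and "q = x 2 1 - x 2 2"
  \<comment> \<open>A nonzero linear combination of \<open>\<epsilon>\<close> over two individuals and two periods that annihilates
    individual effects and the regressor; it vanishes whenever the within residuals do.\<close>
  obtain p' q' where pq: "q' * p = p' * q" "p' \<noteq> 0 \<or> q' \<noteq> 0"
  proof (cases "p = 0 \<and> q = 0")
    case True
    then show ?thesis using that[of 1 0] by simp
  next
    case False
    then show ?thesis using that[of q p] by auto
  qed
  define c :: "nat \<times> nat \<Rightarrow> real" where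
    "c k = (if k = (1, 1) then q' else 0) - (if k = (1, 2) then q' else 0)
         - (if k = (2, 1) then p' else 0) + (if k = (2, 2) then p' else 0)" for k
  have c: "(\<Sum>k\<in>?J. c k * f k) = q' * (f (1, 1) - f (1, 2)) - p' * (f (2, 1) - f (2, 2))" for f :: "nat \<times> nat \<Rightarrow> real"
    using assms by (simp add: c_def algebra_simps sum.distrib sum_subtractf if_distrib[of "\<lambda>u. _ * u"] cong: if_cong)
  have "\<exists>k\<in>?J. c k \<noteq> 0"
    using pq(2) assms by (intro bexI[of _ "if q' \<noteq> 0 then (1, 1) else (2, 1)"]) (auto simp: c_def)
  then obtain k where "k \<in> ?J" "c k \<noteq> 0" by blast
  then have "AE \<omega> in M. (\<Sum>k\<in>?J. c k * (\<lambda>(i, t). \<epsilon> i t) k \<omega>) \<noteq> 0"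
    using sigma_eps_pos by (intro AE_normal_lincomb_nonzero[OF _ indep_eps]) (auto intro: eps_normal)
  then show ?thesis
  proof (rule AE_mp, intro AE_I2 impI notI)
    fix \<omega> assume nz: "(\<Sum>k\<in>?J. c k * (\<lambda>(i, t). \<epsilon> i t) k \<omega>) \<noteq> 0"
      and z: "var_eps_hat N T x (\<lambda>i t. \<epsilon> i t \<omega>) = 0"
    \<comment> \<open>With zero residuals the difference of the first two periods is the same
      multiple \<open>\<beta>\<close> of the regressor difference for both individuals, so the
      combination cancels.\<close>
    define \<beta> where "\<beta> = b_within N T x (\<lambda>i t. \<epsilon> i t \<omega>)"
    have "\<epsilon> i 1 \<omega> - \<epsilon> i 2 \<omega> = \<beta> * (x i 1 - x i 2)" if "i \<in> {1..N}" for i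
      using var_eps_hat_eq_0D[OF z, of i 1] var_eps_hat_eq_0D[OF z, of i 2] that assms
      by (simp add: \<beta>_def[symmetric] algebra_simps)
    from this[of 1] this[of 2] have "\<epsilon> 1 1 \<omega> - \<epsilon> 1 2 \<omega> = \<beta> * p" "\<epsilon> 2 1 \<omega> - \<epsilon> 2 2 \<omega> = \<beta> * q"
      using assms by (auto simp: p_def q_def)
    then have "(\<Sum>k\<in>?J. c k * (\<lambda>(i, t). \<epsilon> i t) k \<omega>) = \<beta> * (q' * p - p' * q)"
      unfolding c by (simp add: algebra_simps)
    with nz pq(1) show False by simp
  qed
qed

lemma nu_pivot_eq_scale_free_ratio:
  assumes "SSB N T x > 0" "SSW N T x > 0" "\<omega> \<in> space M"
    and "var_eps_hat N T x (\<lambda>i t. \<epsilon> i t \<omega>) \<noteq> 0"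
  shows "nu_pivot N T x \<sigma>\<^sub>\<eta> \<sigma>\<^sub>\<epsilon> y \<omega>
    = scale_free_ratio N T x (\<lambda>i\<in>{1..N}. \<eta> i \<omega> + (\<Sum>t=1..T. \<epsilon> i t \<omega>) / T) (\<lambda>(i, t)\<in>{1..N} \<times> {1..T}. \<epsilon> i t \<omega>)
      / (\<sigma>\<^sub>\<eta>\<^sup>2 / \<sigma>\<^sub>\<epsilon>\<^sup>2 + 1 / real T)"
proof -
  have T: "T > 0" using two_le_if_SSW_pos[OF assms(2)] by simp
  let ?y = "\<lambda>i t. y i t \<omega>" and ?e = "\<lambda>i t. \<epsilon> i t \<omega>"
  let ?u = "\<lambda>i\<in>{1..N}. \<eta> i \<omega> + (\<Sum>t=1..T. \<epsilon> i t \<omega>) / T"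
  let ?h = "\<lambda>(i, t)\<in>{1..N} \<times> {1..T}. \<epsilon> i t \<omega>"
  have V: "var_eps_hat N T x ?y = 1\<^sup>2 * var_eps_hat N T x ?e"
    using outcome[OF _ _ assms(3)]
    by (intro var_eps_hat_affine[where c = "\<lambda>i. a + \<xi> * mean_ind T x i + \<eta> i \<omega>" and \<beta> = b] T assms) auto
  \<comment> \<open>\<open>V\<close> transfers nonvanishing from the errors to the data; this
    variant expresses the same value through the restricted function required by the product
    space.\<close>
  have V': "var_eps_hat N T x ?y = 1\<^sup>2 * var_eps_hat N T x (\<lambda>i t. ?h (i, t))"
    using outcome[OF _ _ assms(3)]
    by (intro var_eps_hat_affine[where c = "\<lambda>i. a + \<xi> * mean_ind T x i + \<eta> i \<omega>" and \<beta> = b] T assms) auto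
  have "mean_ind T ?y i = (a + \<xi> * mean_ind T x i + \<eta> i \<omega>) + b * mean_ind T x i + 1 * mean_ind T ?e i"
    if "i \<in> {1..N}" for i
    using outcome[OF that _ assms(3)] by (intro mean_ind_affine T) auto
  \<comment> \<open>Among individual means, \<open>\<xi>\<close> multiplies the regressor itself and
    merges with the slope into \<open>b + \<xi>\<close>, leaving the total error
    \<open>?u\<close>.\<close>
  then have "mean_ind T ?y i = a + (b + \<xi>) * mean_ind T x i + 1 * ?u i" if "i \<in> {1..N}" for i
    using that by (simp add: mean_ind_def[of T ?e] algebra_simps)
  then have "resid_between N T x ?y i = 1 * resid_between N T x (\<lambda>i _. ?u i) i" if "i \<in> {1..N}" for i
    using that by (intro resid_between_affine T assms)
  then have "(\<Sum>i=1..N. (resid_between N T x ?y i)\<^sup>2) = (\<Sum>i=1..N. (resid_between N T x (\<lambda>i _. ?u i) i)\<^sup>2)"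
    by (intro sum.cong) auto
  then show ?thesis
    using nu_hat_add_inverse[OF T, of N x ?y] assms(4) V V'
    by (simp add: nu_pivot_def scale_free_ratio_def)
qed

text \<open>The right-hand side involves only \<open>N\<close>, \<open>T\<close> and
  \<open>x\<close>, which is pivotality. The measures are compared on each Borel set by transforming
  the integral of its indicator.\<close>

lemma distr_nu_pivot:
  assumes "SSB N T x > 0" "SSW N T x > 0"
  shows "distr M borel (nu_pivot N T x \<sigma>\<^sub>\<eta> \<sigma>\<^sub>\<epsilon> y)
    = distr (iid_normal {1..N} 1 \<Otimes>\<^sub>M iid_normal ({1..N} \<times> {1..T}) 1) borel (\<lambda>(v, h). scale_free_ratio N T x v h)"
proof (rule measure_eqI)
  let ?I = "{1..N}" and ?J = "{1..N} \<times> {1..T}"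
  have NT: "N \<ge> 2" "T \<ge> 2" "N > 0" "T > 0"
    using two_le_if_SSB_pos[OF assms(1)] two_le_if_SSW_pos[OF assms(2)] by auto
  define C where "C = \<sigma>\<^sub>\<eta>\<^sup>2 / \<sigma>\<^sub>\<epsilon>\<^sup>2 + 1 / real T"
  define \<gamma> where "\<gamma> = sqrt (\<sigma>\<^sub>\<eta>\<^sup>2 + \<sigma>\<^sub>\<epsilon>\<^sup>2 / card {1..T})"
  have C: "C > 0" using sigma_eta_pos sigma_eps_pos NT by (simp add: C_def add_pos_pos)
  have \<gamma>2: "\<gamma>\<^sup>2 = \<sigma>\<^sub>\<eta>\<^sup>2 + \<sigma>\<^sub>\<epsilon>\<^sup>2 / T" by (simp add: \<gamma>_def)
  have \<gamma>: "\<gamma> > 0" using sigma_eta_pos by (simp add: \<gamma>_def add_pos_nonneg)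
  \<comment> \<open>The variance of the total error is
    \<open>\<sigma>\<^sub>\<epsilon>\<^sup>2\<close> times \<open>C\<close>, so rescaling both
    families multiplies the ratio by exactly the divisor of the pivot.\<close>
  have \<gamma>C: "\<gamma>\<^sup>2 / \<sigma>\<^sub>\<epsilon>\<^sup>2 / C = 1"
    using sigma_eps_pos C unfolding \<gamma>2 by (simp add: C_def field_simps)
  interpret E': prob_space "iid_normal ?J \<sigma>\<^sub>\<epsilon>" by (intro prob_space_iid_normal sigma_eps_pos)
  fix A assume "A \<in> sets (distr M borel (nu_pivot N T x \<sigma>\<^sub>\<eta> \<sigma>\<^sub>\<epsilon> y))"
  then have A [measurable]: "A \<in> sets borel" by simp
  define F where "F v h = (indicator A (scale_free_ratio N T x v h / C) :: ennreal)" for v h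
  have F [measurable]: "case_prod F \<in> borel_measurable (PiM ?I (\<lambda>_. borel) \<Otimes>\<^sub>M PiM ?J (\<lambda>_. borel))"
    unfolding F_def by measurable
  have inv: "F v (\<lambda>k\<in>?J. h k + c (fst k)) = F v h" for v h c
    using scale_free_ratio_scale[of T N x v 1 v "\<lambda>k\<in>?J. h k + c (fst k)" c 1 h] NT assms
    by (simp add: F_def add.commute)
  \<comment> \<open>\<open>G\<close> is \<open>F\<close> before decoupling: its first argument holds
    the bare effects, to which the error means are added.\<close>
  define G where "G g h = F (\<lambda>i\<in>?I. g i + (\<Sum>t\<in>{1..T}. h (i, t)) / card {1..T}) h" for g h
  have "(\<lambda>(g, h). \<lambda>i\<in>?I. g i + (\<Sum>t\<in>{1..T}. h (i, t)) / card {1..T})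
      \<in> measurable (PiM ?I (\<lambda>_. borel) \<Otimes>\<^sub>M PiM ?J (\<lambda>_. borel)) (PiM ?I (\<lambda>_. borel :: real measure))"
    unfolding case_prod_unfold
    by (intro measurable_restrict borel_measurable_add borel_measurable_divide borel_measurable_sum
        borel_measurable_const measurable_compose[OF measurable_fst measurable_component_singleton]
        measurable_compose[OF measurable_snd measurable_component_singleton]) auto
  from measurable_compose[OF measurable_Pair[OF this measurable_snd] F]
  have G [measurable]: "case_prod G \<in> borel_measurable (PiM ?I (\<lambda>_. borel) \<Otimes>\<^sub>M PiM ?J (\<lambda>_. borel))"
    by (simp add: G_def[abs_def] case_prod_unfold)
  then have G': "case_prod G \<in> borel_measurable (iid_normal ?I \<sigma>\<^sub>\<eta> \<Otimes>\<^sub>M iid_normal ?J \<sigma>\<^sub>\<epsilon>)"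
    by (simp only: measurable_iid_normal_pair)
  have meas: "(\<lambda>\<omega>. (\<lambda>i\<in>?I. \<eta> i \<omega>, \<lambda>(i, t)\<in>?J. \<epsilon> i t \<omega>))
      \<in> measurable M (PiM ?I (\<lambda>_. borel) \<Otimes>\<^sub>M PiM ?J (\<lambda>_. borel))"
    by (intro measurable_Pair measurable_restrict) (auto intro: measurable_eta measurable_eps)
  have ratio_meas: "(\<lambda>(v, h). scale_free_ratio N T x v h) \<in> borel_measurable (iid_normal ?I 1 \<Otimes>\<^sub>M iid_normal ?J 1)"
    unfolding measurable_iid_normal_pair by (rule measurable_scale_free_ratio)
  have scale_meas: "(\<lambda>(v, h). (\<lambda>i\<in>?I. \<gamma> * v i, \<lambda>k\<in>?J. \<sigma>\<^sub>\<epsilon> * h k))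
      \<in> measurable (iid_normal ?I 1 \<Otimes>\<^sub>M iid_normal ?J 1) (PiM ?I (\<lambda>_. borel) \<Otimes>\<^sub>M PiM ?J (\<lambda>_. borel))"
    unfolding measurable_iid_normal_pair case_prod_unfold
    by (intro measurable_Pair measurable_restrict borel_measurable_times borel_measurable_const
        measurable_compose[OF measurable_fst measurable_component_singleton]
        measurable_compose[OF measurable_snd measurable_component_singleton])
  have scale_eq: "iid_normal ?I \<gamma> \<Otimes>\<^sub>M iid_normal ?J \<sigma>\<^sub>\<epsilon>
      = distr (iid_normal ?I 1 \<Otimes>\<^sub>M iid_normal ?J 1) (PiM ?I (\<lambda>_. borel) \<Otimes>\<^sub>M PiM ?J (\<lambda>_. borel))
          (\<lambda>(v, h). (\<lambda>i\<in>?I. \<gamma> * v i, \<lambda>k\<in>?J. \<sigma>\<^sub>\<epsilon> * h k))"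
    by (intro iid_normal_pair_scale \<gamma> sigma_eps_pos) auto
  have "emeasure (distr M borel (nu_pivot N T x \<sigma>\<^sub>\<eta> \<sigma>\<^sub>\<epsilon> y)) A
      = (\<integral>\<^sup>+\<omega>. indicator A (nu_pivot N T x \<sigma>\<^sub>\<eta> \<sigma>\<^sub>\<epsilon> y \<omega>) \<partial>M)"
    using measurable_nu_pivot by (subst nn_integral_distr[symmetric]) auto
  \<comment> \<open>The pivot agrees with the ratio only where the error variance estimate is
    nonzero, hence the equality almost everywhere.\<close>
  also have "\<dots> = (\<integral>\<^sup>+\<omega>. G (\<lambda>i\<in>?I. \<eta> i \<omega>) (\<lambda>(i, t)\<in>?J. \<epsilon> i t \<omega>) \<partial>M)"
  proof (rule nn_integral_cong_AE, rule AE_mp[OF AE_var_eps_hat_nonzero[OF NT(1,2)]], intro AE_I2 impI)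
    fix \<omega> assume \<omega>: "\<omega> \<in> space M" "var_eps_hat N T x (\<lambda>i t. \<epsilon> i t \<omega>) \<noteq> 0"
    have "(\<lambda>i\<in>?I. (\<lambda>i\<in>?I. \<eta> i \<omega>) i + (\<Sum>t\<in>{1..T}. (\<lambda>(i, t)\<in>?J. \<epsilon> i t \<omega>) (i, t)) / card {1..T})
        = (\<lambda>i\<in>?I. \<eta> i \<omega> + (\<Sum>t=1..T. \<epsilon> i t \<omega>) / T)"
      by (intro restrict_ext) (auto intro!: sum.cong)
    then show "indicator A (nu_pivot N T x \<sigma>\<^sub>\<eta> \<sigma>\<^sub>\<epsilon> y \<omega>) = G (\<lambda>i\<in>?I. \<eta> i \<omega>) (\<lambda>(i, t)\<in>?J. \<epsilon> i t \<omega>)"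
      by (simp only: G_def F_def C_def nu_pivot_eq_scale_free_ratio[OF assms \<omega>])
  qed
  also have "\<dots> = (\<integral>\<^sup>+p. case_prod G p \<partial>(iid_normal ?I \<sigma>\<^sub>\<eta> \<Otimes>\<^sub>M iid_normal ?J \<sigma>\<^sub>\<epsilon>))"
    unfolding distr_eta_eps[OF NT(3,4), symmetric] by (subst nn_integral_distr[OF meas]) (use G in simp_all)
  also have "\<dots> = (\<integral>\<^sup>+g. \<integral>\<^sup>+h. G g h \<partial>iid_normal ?J \<sigma>\<^sub>\<epsilon> \<partial>iid_normal ?I \<sigma>\<^sub>\<eta>)"
    by (subst E'.nn_integral_fst[OF G', symmetric]) simp
  \<comment> \<open>Decoupling replaces effects plus error means by totals of standard deviation
    \<open>\<gamma>\<close>, independent of the errors.\<close>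
  also have "\<dots> = (\<integral>\<^sup>+u. \<integral>\<^sup>+h. F u h \<partial>iid_normal ?J \<sigma>\<^sub>\<epsilon> \<partial>iid_normal ?I \<gamma>)"
    unfolding G_def \<gamma>_def using NT sigma_eta_pos sigma_eps_pos
    by (intro nn_integral_iid_normal_decouple F inv) auto
  also have "\<dots> = (\<integral>\<^sup>+p. case_prod F p \<partial>(iid_normal ?I \<gamma> \<Otimes>\<^sub>M iid_normal ?J \<sigma>\<^sub>\<epsilon>))"
    using F by (subst E'.nn_integral_fst[symmetric]) (simp_all only: measurable_iid_normal_pair case_prod_conv)
  also have "\<dots> = (\<integral>\<^sup>+p. case_prod F ((\<lambda>(v, h). (\<lambda>i\<in>?I. \<gamma> * v i, \<lambda>k\<in>?J. \<sigma>\<^sub>\<epsilon> * h k)) p)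
      \<partial>(iid_normal ?I 1 \<Otimes>\<^sub>M iid_normal ?J 1))"
    unfolding scale_eq by (subst nn_integral_distr[OF scale_meas]) (use F in simp_all)
  also have "\<dots> = (\<integral>\<^sup>+p. indicator A ((\<lambda>(v, h). scale_free_ratio N T x v h) p)
      \<partial>(iid_normal ?I 1 \<Otimes>\<^sub>M iid_normal ?J 1))"
  proof (intro nn_integral_cong)
    fix p :: "(nat \<Rightarrow> real) \<times> (nat \<times> nat \<Rightarrow> real)"
    obtain v h where p: "p = (v, h)" by fastforce
    have "scale_free_ratio N T x (\<lambda>i\<in>?I. \<gamma> * v i) (\<lambda>k\<in>?J. \<sigma>\<^sub>\<epsilon> * h k) / C
        = \<gamma>\<^sup>2 / \<sigma>\<^sub>\<epsilon>\<^sup>2 / C * scale_free_ratio N T x v h"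
      using scale_free_ratio_scale[of T N x "\<lambda>i\<in>?I. \<gamma> * v i" \<gamma> v "\<lambda>k\<in>?J. \<sigma>\<^sub>\<epsilon> * h k" "\<lambda>_. 0" \<sigma>\<^sub>\<epsilon> h] NT assms
      by simp
    then show "case_prod F ((\<lambda>(v, h). (\<lambda>i\<in>?I. \<gamma> * v i, \<lambda>k\<in>?J. \<sigma>\<^sub>\<epsilon> * h k)) p)
        = indicator A ((\<lambda>(v, h). scale_free_ratio N T x v h) p)"
      unfolding \<gamma>C p by (simp add: F_def)
  qed
  also have "\<dots> = emeasure (distr (iid_normal ?I 1 \<Otimes>\<^sub>M iid_normal ?J 1) borel (\<lambda>(v, h). scale_free_ratio N T x v h)) A"
    using nn_integral_distr[OF ratio_meas, of "indicator A"] by simp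
  finally show "emeasure (distr M borel (nu_pivot N T x \<sigma>\<^sub>\<eta> \<sigma>\<^sub>\<epsilon> y)) A
      = emeasure (distr (iid_normal ?I 1 \<Otimes>\<^sub>M iid_normal ?J 1) borel (\<lambda>(v, h). scale_free_ratio N T x v h)) A" .
qed simp

end

theorem theorem3:
  fixes N T :: nat
    and x :: "nat \<Rightarrow> nat \<Rightarrow> real"
    and a b \<xi> \<sigma>\<^sub>\<eta> \<sigma>\<^sub>\<epsilon> a' b' \<xi>' \<sigma>\<^sub>\<eta>' \<sigma>\<^sub>\<epsilon>' :: real
    and M :: "'v measure" and M' :: "'w measure"
    and \<eta> :: "nat \<Rightarrow> 'v \<Rightarrow> real" and \<eta>' :: "nat \<Rightarrow> 'w \<Rightarrow> real"
    and \<epsilon> y :: "nat \<Rightarrow> nat \<Rightarrow> 'v \<Rightarrow> real" and \<epsilon>' y' :: "nat \<Rightarrow> nat \<Rightarrow> 'w \<Rightarrow> real"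
  assumes "SSB N T x > 0"
    and "SSW N T x > 0"
    and "random_effects_model M N T x a b \<xi> \<sigma>\<^sub>\<eta> \<sigma>\<^sub>\<epsilon> \<eta> \<epsilon> y"
    and "random_effects_model M' N T x a' b' \<xi>' \<sigma>\<^sub>\<eta>' \<sigma>\<^sub>\<epsilon>' \<eta>' \<epsilon>' y'"
  shows "nu_pivot N T x \<sigma>\<^sub>\<eta> \<sigma>\<^sub>\<epsilon> y \<in> borel_measurable M
       \<and> nu_pivot N T x \<sigma>\<^sub>\<eta>' \<sigma>\<^sub>\<epsilon>' y' \<in> borel_measurable M'
       \<and> distr M borel (nu_pivot N T x \<sigma>\<^sub>\<eta> \<sigma>\<^sub>\<epsilon> y) = distr M' borel (nu_pivot N T x \<sigma>\<^sub>\<eta>' \<sigma>\<^sub>\<epsilon>' y')"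
  \<comment> \<open>Both laws equal the same law built from standard normal families. Measurability
    is included because \<open>distr\<close> is meaningful only for measurable maps.\<close>
  using random_effects_model.measurable_nu_pivot[OF assms(3)]
    random_effects_model.measurable_nu_pivot[OF assms(4)]
    random_effects_model.distr_nu_pivot[OF assms(3,1,2)]
    random_effects_model.distr_nu_pivot[OF assms(4,1,2)]
  by simp

end
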